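(* Let $\mathcal C\subset\mathbb{P}^{n-1}$ be the real polyhedral cone generated by $v^1,\dots,v^p\in\mathbb{R}^n$, and assume $\mathcal C$ has generic extremities. Then the non-redundant apices of $\mathcal C$ are precisely the vectors $a\in\mathbb{P}^{n-1}$ for which there exist a non-empty proper subset $I\subsetneq[n]$ and $j\in[n]\setminus I$ such that $a$ is an $(I,j)$-vertex of $\mathcal C$. Moreover, for each such $a$ the set $I$ is uniquely determined, and the collection of the half-spaces $\mathcal H(a,I)$ (one for each such $a$) is the unique non-redundant external representation of $\mathcal C$ composed of minimal half-spaces.
   Context: Max-plus semiring $\mathbb{R}_{\max}=\mathbb{R}\cup\{-\infty\}$ with $\oplus=\max$, $\otimes=+$; on $\mathbb{R}_{\max}^n$, componentwise maximum and $\lambda x=(\lambda+x_1,\dots,\lambda+x_n)$. $\mathcal C=\{\lambda_1v^1\oplus\dots\oplus\lambda_pv^p:\lambda_r\in\mathbb{R}_{\max}\}$, identified with its image in $\mathbb{P}^{n-1}=\mathbb{R}^n/\mathbb{R}(1,\dots,1)$, with Hilbert metric $d_H(x,y)=\max_i(x_i-y_i)-\min_i(x_i-y_i)$; $\partial\mathcal C$ is the boundary. $\mathcal C$ has generic extremities if for each $r\in[p]$ there is a closed $d_H$-ball of positive radius containing $v^r$ and contained in $\mathcal C$. For $b\in\mathbb{R}^n$ and non-empty proper $K\subsetneq[n]$, $\mathcal H(b,K)=\{x\in\mathbb{R}_{\max}^n\setminus\{(-\infty,\dots,-\infty)\}:\max_{i\in K}(x_i-b_i)\ge\max_{l\notin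 K}(x_l-b_l)\}$ (modulo constants), apex $b$. $\Sigma$ is the set of all $\mathcal H(b,K)$ with $\mathcal C\subset\mathcal H(b,K)$ and $b\in\mathcal C$; $\tau(\Gamma)=\{\mathcal H\in\Sigma:\bigcap_{\mathcal H'\in\Gamma}\mathcal H'\subset\mathcal H\}$ ($\tau(\emptyset)=\emptyset$); a finite $\Gamma\subset\Sigma$ is a non-redundant external representation of $\mathcal C$ if $\bigcap_{\mathcal H\in\Gamma}\mathcal H=\mathcal C$ and $\mathcal H\notin\tau(\Gamma\setminus\{\mathcal H\})$ for all $\mathcal H\in\Gamma$. $\Sigma_b=\{\mathcal H(b,K):\mathcal C\subset\mathcal H(b,K)\}$; $\tau'(X)=\{b\in\partial\mathcal C:\Sigma_b\subset\tau(\bigcup_{c\in X}\Sigma_c)\}$; the non-redundant apices form the unique inclusion-minimal finite $X\subset\partial\mathcal C$ with $\tau'(X)=\partial\mathcal C$. A half-space is minimal with respect to $\mathcal C$ if inclusion-minimal among all (possibly degenerate) half-spaces $\{x:\max_{i\in I'}(x_i-\alpha_i)\ge\max_{l\in J'}(x_l-\alpha_l)\}$ ($I',J'$ disjoint non-empty, $\alpha_h\in\mathbb{R}$) containing $\mathcal C$. Types: $S_l(x)=\{r\in[p]:v^r_l-x_l\ge v^r_i-x_i\ \forall i\}$. $a$ is an $(I,j)$-vertex if (C1) $\bigcup_{i\in I}S_i(a)=[p]$; (C2) for each $k\notin I$ some $i\in I$ has $S_i(a)\cap S_k(a)\neq\emptyset$; (C4) for each $i\in I$, $S_i(a)\cap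 S_j(a)\not\subset\bigcup_{k\in I\setminus\{i\}}S_k(a)$. *)

theory Defs
  imports "HOL-Analysis.Analysis"
begin

section \<open>The projective space and the Hilbert metric\<close>

definition hilbert_dist :: "real ^ 'n \<Rightarrow> real ^ 'n \<Rightarrow> real" where
  "hilbert_dist x y = Max (range (\<lambda>i. x $ i - y $ i)) - Min (range (\<lambda>i. x $ i - y $ i))"

definition shift_equiv :: "real ^ 'n \<Rightarrow> real ^ 'n \<Rightarrow> bool" where
  "shift_equiv x y \<longleftrightarrow> (\<exists>c. \<forall>i. x $ i = c + y $ i)"

lemma shift_equiv_equivp: "equivp (shift_equiv :: real ^ 'n \<Rightarrow> real ^ 'n \<Rightarrow> bool)"
proof (rule equivpI)
  show "reflp (shift_equiv :: real ^ 'n \<Rightarrow> real ^ 'n \<Rightarrow> bool)"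
    by (rule reflpI) (auto simp: shift_equiv_def intro: exI[of _ 0])
  show "symp (shift_equiv :: real ^ 'n \<Rightarrow> real ^ 'n \<Rightarrow> bool)"
  proof (rule sympI)
    fix x y :: "real ^ 'n"
    assume "shift_equiv x y"
    then obtain c where "\<forall>i. x $ i = c + y $ i"
      by (auto simp: shift_equiv_def)
    then have "\<forall>i. y $ i = - c + x $ i"
      by simp
    then show "shift_equiv y x"
      unfolding shift_equiv_def by blast
  qed
  show "transp (shift_equiv :: real ^ 'n \<Rightarrow> real ^ 'n \<Rightarrow> bool)"
  proof (rule transpI)
    fix x y z :: "real ^ 'n"
    assume "shift_equiv x y" "shift_equiv y z"
    then obtain c d where "\<forall>i. x $ i = c + y $ i" "\<forall>i. y $ i = d + z $ i"
      by (auto simp: shift_equiv_def)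
    then have "\<forall>i. x $ i = (c + d) + z $ i"
      by simp
    then show "shift_equiv x z"
      unfolding shift_equiv_def by blast
  qed
qed

quotient_type 'n trop_proj = "real ^ 'n" / shift_equiv
  morphisms rep_proj proj
  by (rule shift_equiv_equivp)

lemma hilbert_dist_upper: "x $ i - y $ i - (x $ j - y $ j) \<le> hilbert_dist x y"
  for x y :: "real ^ 'n"
proof -
  have "x $ i - y $ i \<le> Max (range (\<lambda>i. x $ i - y $ i))"
    by (intro Max_ge) auto
  moreover have "Min (range (\<lambda>i. x $ i - y $ i)) \<le> x $ j - y $ j"
    by (intro Min_le) auto
  ultimately show ?thesis
    unfolding hilbert_dist_def by linarith
qed

lemma hilbert_dist_attained:
  fixes x y :: "real ^ 'n"
  obtains i j where "hilbert_dist x y = x $ i - y $ i - (x $ j - y $ j)"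
proof -
  have "Max (range (\<lambda>i. x $ i - y $ i)) \<in> range (\<lambda>i. x $ i - y $ i)"
    by (intro Max_in) auto
  moreover have "Min (range (\<lambda>i. x $ i - y $ i)) \<in> range (\<lambda>i. x $ i - y $ i)"
    by (intro Min_in) auto
  ultimately show ?thesis
    using that unfolding hilbert_dist_def by (metis (no_types, lifting) imageE)
qed

instantiation trop_proj :: (finite) metric_space
begin

lift_definition dist_trop_proj :: "'a trop_proj \<Rightarrow> 'a trop_proj \<Rightarrow> real" is hilbert_dist
proof -
  have le: "hilbert_dist x y \<le> hilbert_dist x' y'"
    if equiv: "shift_equiv x x'" "shift_equiv y y'" for x x' y y' :: "real ^ 'a"
  proof -
    obtain i j where ij: "hilbert_dist x y = x $ i - y $ i - (x $ j - y $ j)"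
      by (rule hilbert_dist_attained)
    obtain c d where "\<forall>i. x $ i = c + x' $ i" "\<forall>i. y $ i = d + y' $ i"
      using equiv unfolding shift_equiv_def by blast
    then show ?thesis
      using hilbert_dist_upper[of x' i y' j] ij by simp
  qed
  fix x x' y y' :: "real ^ 'a"
  assume "shift_equiv x x'" "shift_equiv y y'"
  then show "hilbert_dist x y = hilbert_dist x' y'"
    by (intro antisym le) (auto intro: equivp_symp[OF shift_equiv_equivp])
qed

definition uniformity_trop_proj :: "('a trop_proj \<times> 'a trop_proj) filter" where
  "uniformity_trop_proj = (INF e\<in>{0<..}. principal {(x, y). dist x y < e})"

definition open_trop_proj :: "'a trop_proj set \<Rightarrow> bool" where
  "open_trop_proj U \<longleftrightarrow> (\<forall>x\<in>U. eventually (\<lambda>(x', y). x' = x \<longrightarrow> y \<in> U) uniformity)"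

instance
proof
  fix x y z :: "'a trop_proj"
  show "dist x y = 0 \<longleftrightarrow> x = y"
  proof (transfer, rule iffI)
    fix x y :: "real ^ 'a"
    assume 0: "hilbert_dist x y = 0"
    have "x $ i - y $ i = x $ j - y $ j" for i j
      using hilbert_dist_upper[of x i y j] hilbert_dist_upper[of x j y i] 0 by simp
    then have "\<forall>i. x $ i = (x $ undefined - y $ undefined) + y $ i"
      by (metis diff_add_cancel)
    then show "shift_equiv x y"
      unfolding shift_equiv_def by blast
  next
    fix x y :: "real ^ 'a"
    assume "shift_equiv x y"
    then show "hilbert_dist x y = 0"
      by (auto simp: shift_equiv_def hilbert_dist_def)
  qed
  show "dist x y \<le> dist x z + dist y z"
  proof transfer
    fix x y z :: "real ^ 'a"
    obtain i j where "hilbert_dist x y = x $ i - y $ i - (x $ j - y $ j)"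
      by (rule hilbert_dist_attained)
    then show "hilbert_dist x y \<le> hilbert_dist x z + hilbert_dist y z"
      using hilbert_dist_upper[of x i z j] hilbert_dist_upper[of y j z i] by simp
  qed
qed (simp_all only: uniformity_trop_proj_def open_trop_proj_def)

end


section \<open>Cones and half-spaces\<close>

text \<open>
  Max-plus scalars are the extended reals different from \<open>\<infinity>\<close>. The all-\<open>-\<infinity>\<close> vector has no
  projective class and is excluded. Cones and half-spaces are kept as subsets of this set of
  vectors; they are invariant under adding a real constant to all coordinates, so inclusion,
  intersection and equality of such sets are the same as for their images modulo constants.
\<close>

definition rmax_vecs :: "(ereal ^ 'n) set" where
  "rmax_vecs = {x. (\<forall>i. x $ i \<noteq> \<infinity>) \<and> (\<exists>i. x $ i \<noteq> - \<infinity>)}"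

definition trop_cone :: "('p::finite \<Rightarrow> real ^ 'n) \<Rightarrow> (ereal ^ 'n) set" where
  "trop_cone v = {x \<in> rmax_vecs. \<exists>c :: 'p \<Rightarrow> ereal. (\<forall>r. c r \<noteq> \<infinity>) \<and>
     (\<forall>i. x $ i = (SUP r. c r + ereal (v r $ i)))}"

definition proj_cone :: "('p::finite \<Rightarrow> real ^ 'n) \<Rightarrow> 'n trop_proj set" where
  "proj_cone v = proj ` {x. (\<chi> i. ereal (x $ i)) \<in> trop_cone v}"

definition generic_extremities :: "('p::finite \<Rightarrow> real ^ 'n) \<Rightarrow> bool" where
  "generic_extremities v \<longleftrightarrow>
     (\<forall>r. \<exists>z R. R > 0 \<and> proj (v r) \<in> cball z R \<and> cball z R \<subseteq> proj_cone v)"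

text \<open>A possibly degenerate half-space; it is non-degenerate if \<open>J\<close> is the complement of \<open>I\<close>.\<close>

definition gen_halfspace :: "real ^ 'n \<Rightarrow> 'n set \<Rightarrow> 'n set \<Rightarrow> (ereal ^ 'n) set" where
  "gen_halfspace a I J = {x \<in> rmax_vecs.
     (SUP i\<in>I. x $ i - ereal (a $ i)) \<ge> (SUP l\<in>J. x $ l - ereal (a $ l))}"

lemma gen_halfspace_shift:
  assumes "shift_equiv a b"
  shows "gen_halfspace a I J \<subseteq> gen_halfspace b I J"
proof
  fix x
  assume x: "x \<in> gen_halfspace a I J"
  obtain c where c: "\<And>i. a $ i = c + b $ i"
    using assms by (auto simp: shift_equiv_def)
  have fin: "x $ i \<noteq> \<infinity>" for i
    using x by (auto simp: gen_halfspace_def rmax_vecs_def)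
  have eq: "x $ i - ereal (b $ i) = (x $ i - ereal (a $ i)) + ereal c" for i
    using fin[of i] by (cases "x $ i") (simp_all add: c)
  have sup: "(SUP i\<in>K. x $ i - ereal (b $ i)) = (SUP i\<in>K. x $ i - ereal (a $ i)) + ereal c" for K
  proof (cases "K = {}")
    case True
    then show ?thesis by (simp add: bot_ereal_def)
  next
    case False
    then show ?thesis
      unfolding eq by (intro SUP_ereal_add_left) auto
  qed
  show "x \<in> gen_halfspace b I J"
    using x unfolding gen_halfspace_def mem_Collect_eq sup by (auto intro: add_right_mono)
qed

lift_definition halfspace :: "'n::finite trop_proj \<Rightarrow> 'n set \<Rightarrow> (ereal ^ 'n) set"
  is "\<lambda>b K. gen_halfspace b K (- K)"
  by (intro ext equalityI gen_halfspace_shift) (auto intro: equivp_symp[OF shift_equiv_equivp])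

definition minimal_halfspace :: "('p::finite \<Rightarrow> real ^ 'n) \<Rightarrow> (ereal ^ 'n) set \<Rightarrow> bool" where
  "minimal_halfspace v H \<longleftrightarrow>
     (let \<H> = {H'. \<exists>a I J. I \<noteq> {} \<and> J \<noteq> {} \<and> I \<inter> J = {} \<and>
                    H' = gen_halfspace a I J \<and> trop_cone v \<subseteq> H'}
      in H \<in> \<H> \<and> (\<forall>H'\<in>\<H>. H' \<subseteq> H \<longrightarrow> H' = H))"


section \<open>External representations and non-redundant apices\<close>

definition halfspaces_at ::
    "('p::finite \<Rightarrow> real ^ 'n) \<Rightarrow> 'n trop_proj \<Rightarrow> (ereal ^ 'n) set set" where
  "halfspaces_at v b = {halfspace b K | K. K \<noteq> {} \<and> K \<noteq> UNIV \<and> trop_cone v \<subseteq> halfspace b K}"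

definition halfspaces_of :: "('p::finite \<Rightarrow> real ^ 'n) \<Rightarrow> (ereal ^ 'n) set set" where
  "halfspaces_of v = (\<Union>b\<in>proj_cone v. halfspaces_at v b)"

text \<open>The empty intersection is the whole space of non-\<open>-\<infinity>\<close> vectors.\<close>

definition inter_halfspaces :: "(ereal ^ 'n) set set \<Rightarrow> (ereal ^ 'n) set" where
  "inter_halfspaces \<Gamma> = rmax_vecs \<inter> \<Inter>\<Gamma>"

definition tau ::
    "('p::finite \<Rightarrow> real ^ 'n) \<Rightarrow> (ereal ^ 'n) set set \<Rightarrow> (ereal ^ 'n) set set" where
  "tau v \<Gamma> = (if \<Gamma> = {} then {} else {H \<in> halfspaces_of v. inter_halfspaces \<Gamma> \<subseteq> H})"

definition nonredundant_ext_rep ::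
    "('p::finite \<Rightarrow> real ^ 'n) \<Rightarrow> (ereal ^ 'n) set set \<Rightarrow> bool" where
  "nonredundant_ext_rep v \<Gamma> \<longleftrightarrow> finite \<Gamma> \<and> \<Gamma> \<subseteq> halfspaces_of v \<and>
     inter_halfspaces \<Gamma> = trop_cone v \<and> (\<forall>H\<in>\<Gamma>. H \<notin> tau v (\<Gamma> - {H}))"

definition tau' :: "('p::finite \<Rightarrow> real ^ 'n) \<Rightarrow> 'n trop_proj set \<Rightarrow> 'n trop_proj set" where
  "tau' v X = {b \<in> frontier (proj_cone v).
     halfspaces_at v b \<subseteq> tau v (\<Union>c\<in>X. halfspaces_at v c)}"

definition spanning_apices :: "('p::finite \<Rightarrow> real ^ 'n) \<Rightarrow> 'n trop_proj set \<Rightarrow> bool" where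
  "spanning_apices v X \<longleftrightarrow> finite X \<and> X \<subseteq> frontier (proj_cone v) \<and>
     tau' v X = frontier (proj_cone v)"

definition minimal_spanning_apices ::
    "('p::finite \<Rightarrow> real ^ 'n) \<Rightarrow> 'n trop_proj set \<Rightarrow> bool" where
  "minimal_spanning_apices v X \<longleftrightarrow>
     spanning_apices v X \<and> (\<forall>Y. spanning_apices v Y \<and> Y \<subseteq> X \<longrightarrow> Y = X)"

text \<open>
  \<open>nonredundant_apices v X\<close>: the non-redundant apices exist, i.e. there is exactly one
  inclusion-minimal spanning set, and \<open>X\<close> is the set of them.
\<close>

definition nonredundant_apices :: "('p::finite \<Rightarrow> real ^ 'n) \<Rightarrow> 'n trop_proj set \<Rightarrow> bool" where
  "nonredundant_apices v X \<longleftrightarrow>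
     minimal_spanning_apices v X \<and> (\<forall>Y. minimal_spanning_apices v Y \<longrightarrow> Y = X)"


section \<open>Types and vertices\<close>

lift_definition type_sector ::
    "('p::finite \<Rightarrow> real ^ 'n) \<Rightarrow> 'n::finite trop_proj \<Rightarrow> 'n \<Rightarrow> 'p set"
  is "\<lambda>v x l. {r. \<forall>i. v r $ l - x $ l \<ge> v r $ i - x $ i}"
  by (auto simp: shift_equiv_def)

definition is_vertex ::
    "('p::finite \<Rightarrow> real ^ 'n) \<Rightarrow> 'n set \<Rightarrow> 'n \<Rightarrow> 'n trop_proj \<Rightarrow> bool" where
  "is_vertex v I j a \<longleftrightarrow>
     (let S = type_sector v a in
       (\<Union>i\<in>I. S i) = UNIV \<and>
       (\<forall>k. k \<notin> I \<longrightarrow> (\<exists>i\<in>I. S i \<inter> S k \<noteq> {})) \<and>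
       (\<forall>i\<in>I. \<not> S i \<inter> S j \<subseteq> (\<Union>k\<in>I - {i}. S k)))"

end

theory Submission
  imports Defs
begin

text \<open>
  Three observations carry the proof. A valid inequality \<open>x\<^sub>j \<le> max\<^sub>i (c\<^sub>i + x\<^sub>i)\<close> on the cone that is
  violated by \<open>x\<close> can be lowered to a minimal one, and the minimal ones are exactly those read off
  from \<open>(I, j)\<close>-vertices; hence the half-spaces at vertices already cut out the cone. With generic
  extremities the supports \<open>K\<close> of half-spaces \<open>\<H>(a, K)\<close> containing the cone are closed under
  intersection, which makes \<open>I\<close> the least support at its vertex. Finally, moving an
  \<open>(I, j)\<close>-vertex \<open>a\<close> slightly in direction \<open>e\<^sub>j\<close> leaves \<open>\<H>(a, I)\<close> but no half-space containing
  the cone whose apex is another point of the cone, so no vertex can be dispensed with.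
\<close>

section \<open>Cones and half-spaces in real coordinates\<close>

definition ereal_vec :: "real ^ 'n \<Rightarrow> ereal ^ 'n" where
  "ereal_vec x = (\<chi> i. ereal (x $ i))"

lemma ereal_vec_nth [simp]: "ereal_vec x $ i = ereal (x $ i)"
  by (simp add: ereal_vec_def)

lemma ereal_vec_in_rmax_vecs [simp]: "ereal_vec x \<in> rmax_vecs"
  by (simp add: rmax_vecs_def)

lemma le_SUP_finite_iff:
  fixes f :: "'a \<Rightarrow> 'b :: complete_linorder"
  assumes "finite I" "I \<noteq> {}"
  shows "y \<le> (SUP i\<in>I. f i) \<longleftrightarrow> (\<exists>i\<in>I. y \<le> f i)"
  using assms by (simp add: cSup_eq_Max Max_ge_iff)

lemma finite_argmax:
  fixes f :: "'a \<Rightarrow> 'b :: linorder"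
  assumes "finite A" "A \<noteq> {}"
  obtains x where "x \<in> A" "\<And>y. y \<in> A \<Longrightarrow> f y \<le> f x"
proof -
  have "Max (f ` A) \<in> f ` A"
    using assms by (intro Max_in) auto
  then obtain x where "x \<in> A" "f x = Max (f ` A)"
    by auto
  with assms that show thesis
    by simp
qed

lemma gen_halfspace_iff:
  assumes "I \<noteq> {}" "x \<in> rmax_vecs"
  shows "x \<in> gen_halfspace a I J \<longleftrightarrow>
    (\<forall>l\<in>J. \<exists>i\<in>I. x $ l - ereal (a $ l) \<le> x $ i - ereal (a $ i))"
  using assms by (simp add: gen_halfspace_def SUP_le_iff le_SUP_finite_iff)

lemma ereal_vec_in_gen_halfspace_iff:
  assumes "I \<noteq> {}"
  shows "ereal_vec x \<in> gen_halfspace a I J \<longleftrightarrow>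
    (\<forall>l\<in>J. \<exists>i\<in>I. x $ l - a $ l \<le> x $ i - a $ i)"
  using assms by (simp add: gen_halfspace_iff)

lemma shift_equiv_gen_halfspace:
  assumes "shift_equiv a b"
  shows "gen_halfspace a I J = gen_halfspace b I J"
  using gen_halfspace_shift[OF assms] gen_halfspace_shift[OF equivp_symp[OF shift_equiv_equivp assms]]
  by blast

text \<open>One finite coefficient over real generators makes all entries finite, so the cone
  consists of real vectors. The right-hand side says that every sector of the type of
  \<open>y\<close> is non-empty.\<close>

lemma trop_cone_iff:
  "x \<in> trop_cone v \<longleftrightarrow>
    (\<exists>y. x = ereal_vec y \<and> (\<forall>l. \<exists>r. \<forall>i. v r $ i - y $ i \<le> v r $ l - y $ l))"
proof
  assume x: "x \<in> trop_cone v"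
  then obtain c where c: "\<And>r. c r \<noteq> \<infinity>"
    and sup: "\<And>i. x $ i = (SUP r. c r + ereal (v r $ i))" and rm: "x \<in> rmax_vecs"
    by (auto simp: trop_cone_def)
  have ge: "c r + ereal (v r $ i) \<le> x $ i" for r i
    unfolding sup by (rule SUP_upper) simp
  have attained: "\<exists>r. x $ i = c r + ereal (v r $ i)" for i
    using le_SUP_finite_iff[of UNIV "x $ i" "\<lambda>r. c r + ereal (v r $ i)"] ge[of _ i] sup[of i]
    by (auto intro: antisym)
  obtain r0 where r0: "c r0 \<noteq> - \<infinity>"
    using rm attained by (force simp: rmax_vecs_def)
  have fin: "\<bar>x $ i\<bar> \<noteq> \<infinity>" for i
    using ge[of r0 i] r0 c[of r0] rm by (cases "c r0") (auto simp: rmax_vecs_def)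
  define y where "y = (\<chi> i. real_of_ereal (x $ i))"
  have y: "x $ i = ereal (y $ i)" for i
    using fin[of i] by (simp add: y_def ereal_real')
  have "\<exists>r. \<forall>i. v r $ i - y $ i \<le> v r $ l - y $ l" for l
  proof -
    obtain r where r: "x $ l = c r + ereal (v r $ l)"
      using attained by blast
    have "v r $ i - y $ i \<le> v r $ l - y $ l" for i
      using r ge[of r i] unfolding y by (cases "c r") auto
    then show ?thesis by blast
  qed
  then show "\<exists>y. x = ereal_vec y \<and> (\<forall>l. \<exists>r. \<forall>i. v r $ i - y $ i \<le> v r $ l - y $ l)"
    using y by (intro exI[of _ y]) (simp add: vec_eq_iff)
next
  assume "\<exists>y. x = ereal_vec y \<and> (\<forall>l. \<exists>r. \<forall>i. v r $ i - y $ i \<le> v r $ l - y $ l)"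
  then obtain y where x: "x = ereal_vec y"
    and y: "\<And>l. \<exists>r. \<forall>i. v r $ i - y $ i \<le> v r $ l - y $ l"
    by blast
  \<comment> \<open>\<open>m r\<close> is the largest scalar for which \<open>m r + v r\<close>
    stays below \<open>y\<close>.\<close>
  define m where "m r = Min (range (\<lambda>i. y $ i - v r $ i))" for r
  have m_le: "m r \<le> y $ i - v r $ i" for r i
    unfolding m_def by (intro Min_le) auto
  have "ereal (y $ l) = (SUP r. ereal (m r) + ereal (v r $ l))" for l
  proof (rule antisym)
    obtain r where r: "\<And>i. v r $ i - y $ i \<le> v r $ l - y $ l"
      using y by blast
    have "y $ l - v r $ l \<le> y $ i - v r $ i" for i
      using r[of i] by linarith
    then have "y $ l - v r $ l \<le> m r"
      unfolding m_def by (intro Min.boundedI) auto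
    then have "ereal (y $ l) \<le> ereal (m r) + ereal (v r $ l)"
      by simp
    also have "\<dots> \<le> (SUP r. ereal (m r) + ereal (v r $ l))"
      by (rule SUP_upper) simp
    finally show "ereal (y $ l) \<le> (SUP r. ereal (m r) + ereal (v r $ l))" .
    have "ereal (m r) + ereal (v r $ l) \<le> ereal (y $ l)" for r
      using m_le[of r l] by simp
    then show "(SUP r. ereal (m r) + ereal (v r $ l)) \<le> ereal (y $ l)"
      by (intro SUP_least) simp
  qed
  then show "x \<in> trop_cone v"
    unfolding trop_cone_def x by (auto intro!: exI[of _ "\<lambda>r. ereal (m r)"])
qed

lemma ereal_vec_in_trop_cone_iff:
  "ereal_vec x \<in> trop_cone v \<longleftrightarrow> (\<forall>l. \<exists>r. \<forall>i. v r $ i - x $ i \<le> v r $ l - x $ l)"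
  by (auto simp: trop_cone_iff vec_eq_iff)

lemma generator_in_trop_cone: "ereal_vec (v r) \<in> trop_cone v"
  unfolding ereal_vec_in_trop_cone_iff by (intro allI exI[of _ r]) simp

lemma trop_cone_subset_rmax_vecs: "trop_cone v \<subseteq> rmax_vecs"
  by (auto simp: trop_cone_def)

text \<open>Testing on generators suffices: a generator in sector \<open>l\<close> of
  \<open>y\<close> exceeds \<open>y\<close> most at \<open>l\<close>, so its inequality at
  \<open>l\<close> passes to \<open>y\<close> with the same index \<open>i\<close>.\<close>

lemma trop_cone_subset_iff:
  assumes "I \<noteq> {}"
  shows "trop_cone v \<subseteq> gen_halfspace a I J \<longleftrightarrow>
    (\<forall>r. \<forall>l\<in>J. \<exists>i\<in>I. v r $ l - a $ l \<le> v r $ i - a $ i)"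
proof
  assume "trop_cone v \<subseteq> gen_halfspace a I J"
  then show "\<forall>r. \<forall>l\<in>J. \<exists>i\<in>I. v r $ l - a $ l \<le> v r $ i - a $ i"
    using generator_in_trop_cone ereal_vec_in_gen_halfspace_iff[OF assms] by blast
next
  assume gen: "\<forall>r. \<forall>l\<in>J. \<exists>i\<in>I. v r $ l - a $ l \<le> v r $ i - a $ i"
  show "trop_cone v \<subseteq> gen_halfspace a I J"
  proof
    fix x
    assume "x \<in> trop_cone v"
    then obtain y where x: "x = ereal_vec y"
      and y: "\<And>l. \<exists>r. \<forall>i. v r $ i - y $ i \<le> v r $ l - y $ l"
      by (auto simp: trop_cone_iff)
    have "\<exists>i\<in>I. y $ l - a $ l \<le> y $ i - a $ i" if l: "l \<in> J" for l
    proof -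
      obtain r where r: "\<And>i. v r $ i - y $ i \<le> v r $ l - y $ l"
        using y by blast
      obtain i where "i \<in> I" "v r $ l - a $ l \<le> v r $ i - a $ i"
        using gen l by blast
      with r[of i] show ?thesis
        by (intro bexI[of _ i]) auto
    qed
    then show "x \<in> gen_halfspace a I J"
      unfolding x ereal_vec_in_gen_halfspace_iff[OF assms] by blast
  qed
qed

lemma proj_cases: obtains x where "p = proj x"
  using Quotient_abs_rep[OF Quotient_trop_proj, of p] that[of "rep_proj p"] by simp

lemma proj_eq_iff: "proj x = proj y \<longleftrightarrow> shift_equiv x y"
  using trop_proj.abs_eq_iff .

lemma proj_in_proj_cone_iff: "proj x \<in> proj_cone v \<longleftrightarrow> ereal_vec x \<in> trop_cone v"
proof
  assume "proj x \<in> proj_cone v"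
  then obtain y where y: "ereal_vec y \<in> trop_cone v" and "proj x = proj y"
    by (auto simp: proj_cone_def ereal_vec_def)
  then obtain c where "\<And>i. x $ i = c + y $ i"
    by (auto simp: proj_eq_iff shift_equiv_def)
  with y show "ereal_vec x \<in> trop_cone v"
    by (auto simp: ereal_vec_in_trop_cone_iff)
qed (auto simp: proj_cone_def ereal_vec_def)

text \<open>Outside the cone some sector \<open>j\<close> is empty, which amounts to finitely many
  strict inequalities between coordinate differences; a point closer than the smallest gap
  \<open>e\<close> keeps them all.\<close>

lemma closed_proj_cone: "closed (proj_cone v)"
  unfolding closed_def open_dist
proof
  fix p
  assume "p \<in> - proj_cone v"
  moreover obtain x where p: "p = proj x"
    by (rule proj_cases)
  ultimately obtain j where "\<forall>r. \<exists>i. v r $ j - x $ j < v r $ i - x $ i"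
    by (auto simp: proj_in_proj_cone_iff ereal_vec_in_trop_cone_iff not_le)
  then obtain f where f: "\<And>r. v r $ j - x $ j < v r $ f r - x $ f r"
    by metis
  define e where "e = Min (range (\<lambda>r. v r $ f r - x $ f r - (v r $ j - x $ j)))"
  have "e > 0"
    using f by (simp add: e_def)
  moreover have "q \<notin> proj_cone v" if q: "dist q p < e" for q
  proof -
    obtain y where y: "q = proj y"
      by (rule proj_cases)
    have d: "hilbert_dist y x < e"
      using q by (simp add: y p dist_trop_proj.abs_eq)
    have "v r $ j - y $ j < v r $ f r - y $ f r" for r
    proof -
      have "e \<le> v r $ f r - x $ f r - (v r $ j - x $ j)"
        unfolding e_def by (intro Min_le) auto
      with d hilbert_dist_upper[of y "f r" x j] show ?thesis
        by linarith
    qed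
    then show ?thesis
      unfolding y proj_in_proj_cone_iff ereal_vec_in_trop_cone_iff by (meson not_le)
  qed
  ultimately show "\<exists>e>0. \<forall>q. dist q p < e \<longrightarrow> q \<in> - proj_cone v"
    by auto
qed

lemma halfspace_proj: "halfspace (proj b) K = gen_halfspace b K (- K)"
  by (simp add: halfspace.abs_eq)

lemma halfspaces_at_proj:
  "halfspaces_at v (proj b) = {gen_halfspace b K (- K) | K.
     K \<noteq> {} \<and> K \<noteq> UNIV \<and> trop_cone v \<subseteq> gen_halfspace b K (- K)}"
  by (simp add: halfspaces_at_def halfspace_proj)

text \<open>\<open>tau\<close> is \<open>{}\<close> on the empty family, whose intersection is
  \<open>rmax_vecs\<close>; this fact serves to show that a family implying a half-space is not
  empty.\<close>

lemma rmax_vecs_not_subset_gen_halfspace: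
  assumes "K \<noteq> {}" "K \<noteq> UNIV"
  shows "\<not> rmax_vecs \<subseteq> gen_halfspace b K (- K)"
proof -
  obtain l where l: "l \<notin> K"
    using assms by auto
  have "ereal_vec (b + axis l 1) \<notin> gen_halfspace b K (- K)"
  proof
    assume "ereal_vec (b + axis l 1) \<in> gen_halfspace b K (- K)"
    then obtain i where "i \<in> K" "(b + axis l 1) $ l - b $ l \<le> (b + axis l 1) $ i - b $ i"
      using l unfolding ereal_vec_in_gen_halfspace_iff[OF assms(1)] by blast
    with l show False
      by (auto simp: axis_def split: if_splits)
  qed
  then show ?thesis
    using ereal_vec_in_rmax_vecs by blast
qed

section \<open>Vertices in coordinates\<close>

lemma type_sector_proj:
  "type_sector v (proj a) l = {r. \<forall>i. v r $ i - a $ i \<le> v r $ l - a $ l}"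
  by (simp add: type_sector.abs_eq)

text \<open>The conjuncts are (C1), (C2) and (C4) read on the entries of \<open>v r - a\<close>:
  lying in two sectors means a tie for the maximum. In (C4) the generator ties at \<open>j\<close>
  and \<open>i\<close> and is strictly smaller on the rest of \<open>I\<close>.\<close>

lemma is_vertex_proj_iff:
  "is_vertex v I j (proj a) \<longleftrightarrow>
     (\<forall>r. \<exists>i\<in>I. \<forall>l. v r $ l - a $ l \<le> v r $ i - a $ i) \<and>
     (\<forall>k. k \<notin> I \<longrightarrow> (\<exists>i\<in>I. \<exists>r. v r $ i - a $ i = v r $ k - a $ k \<and>
        (\<forall>l. v r $ l - a $ l \<le> v r $ k - a $ k))) \<and>
     (\<forall>i\<in>I. \<exists>r. v r $ i - a $ i = v r $ j - a $ j \<and>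
        (\<forall>l. v r $ l - a $ l \<le> v r $ j - a $ j) \<and>
        (\<forall>k\<in>I - {i}. v r $ k - a $ k < v r $ j - a $ j))"
proof -
  define S where "S = type_sector v (proj a)"
  have S: "r \<in> S l \<longleftrightarrow> (\<forall>i. v r $ i - a $ i \<le> v r $ l - a $ l)" for r l
    by (simp add: S_def type_sector_proj)
  have SS: "r \<in> S i \<inter> S k \<longleftrightarrow>
      v r $ i - a $ i = v r $ k - a $ k \<and> (\<forall>l. v r $ l - a $ l \<le> v r $ k - a $ k)" for r i k
    unfolding Int_iff S by (metis order_antisym)
  have SSS: "r \<in> S i \<inter> S j \<and> r \<notin> (\<Union>k\<in>I - {i}. S k) \<longleftrightarrow>
      v r $ i - a $ i = v r $ j - a $ j \<and> (\<forall>l. v r $ l - a $ l \<le> v r $ j - a $ j) \<and>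
        (\<forall>k\<in>I - {i}. v r $ k - a $ k < v r $ j - a $ j)" for r i
    unfolding SS UN_iff S by (meson leD not_le order_trans)
  have C1: "(\<Union>i\<in>I. S i) = UNIV \<longleftrightarrow> (\<forall>r. \<exists>i\<in>I. r \<in> S i)"
    by auto
  have C2: "S i \<inter> S k \<noteq> {} \<longleftrightarrow> (\<exists>r. r \<in> S i \<inter> S k)" for i k
    by auto
  have C4: "\<not> S i \<inter> S j \<subseteq> (\<Union>k\<in>I - {i}. S k) \<longleftrightarrow>
      (\<exists>r. r \<in> S i \<inter> S j \<and> r \<notin> (\<Union>k\<in>I - {i}. S k))" for i
    by auto
  show ?thesis
    unfolding is_vertex_def Let_def S_def[symmetric] C1 C2 C4 SSS unfolding SS S by (rule refl)
qed

lemma vertex_nonempty: "is_vertex v I j (proj a) \<Longrightarrow> I \<noteq> {}"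
  by (auto simp: is_vertex_proj_iff)

lemma trop_cone_subset_vertex_halfspace:
  assumes "is_vertex v I j (proj a)"
  shows "trop_cone v \<subseteq> gen_halfspace a I (- I)"
  using assms unfolding trop_cone_subset_iff[OF vertex_nonempty[OF assms]] is_vertex_proj_iff
  by blast

text \<open>Every sector of \<open>a\<close> is non-empty: (C4) fills those in \<open>I\<close>,
  (C2) the others.\<close>

lemma vertex_in_trop_cone:
  assumes "is_vertex v I j (proj a)"
  shows "ereal_vec a \<in> trop_cone v"
  unfolding ereal_vec_in_trop_cone_iff
proof
  fix l
  show "\<exists>r. \<forall>i. v r $ i - a $ i \<le> v r $ l - a $ l"
    using assms unfolding is_vertex_proj_iff by (cases "l \<in> I") metis+
qed

lemma vertex_perturbation_notin:
  assumes "is_vertex v I j (proj a)" "j \<notin> I" "e > 0"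
  shows "ereal_vec (a + axis j e) \<notin> gen_halfspace a I (- I)"
proof
  assume "ereal_vec (a + axis j e) \<in> gen_halfspace a I (- I)"
  then obtain i where "i \<in> I" "(a + axis j e) $ j - a $ j \<le> (a + axis j e) $ i - a $ i"
    using assms(2) unfolding ereal_vec_in_gen_halfspace_iff[OF vertex_nonempty[OF assms(1)]] by blast
  with assms(2,3) show False
    by (auto simp: axis_def split: if_splits)
qed

text \<open>Raising coordinate \<open>j\<close> of \<open>a\<close> by any positive amount leaves a
  half-space that contains the cone, so no ball around \<open>a\<close> lies in the cone.\<close>

lemma vertex_in_frontier:
  assumes vertex: "is_vertex v I j (proj a)" and j: "j \<notin> I"
  shows "proj a \<in> frontier (proj_cone v)"
proof -
  have "proj a \<in> proj_cone v"
    using vertex_in_trop_cone[OF vertex] by (simp add: proj_in_proj_cone_iff)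
  moreover have "proj a \<notin> interior (proj_cone v)"
  proof
    assume "proj a \<in> interior (proj_cone v)"
    then obtain e where e: "e > 0" "ball (proj a) e \<subseteq> proj_cone v"
      by (auto simp: mem_interior)
    let ?x = "a + axis j (e / 2)"
    obtain k l where "hilbert_dist a ?x = a $ k - ?x $ k - (a $ l - ?x $ l)"
      by (rule hilbert_dist_attained)
    then have "dist (proj a) (proj ?x) < e"
      using e by (auto simp: dist_trop_proj.abs_eq axis_def)
    then have "ereal_vec ?x \<in> trop_cone v"
      using e by (auto simp: proj_in_proj_cone_iff)
    then show False
      using vertex_perturbation_notin[OF vertex j, of "e / 2"] e
        trop_cone_subset_vertex_halfspace[OF vertex] by auto
  qed
  ultimately show ?thesis
    using closed_proj_cone[of v] by (simp add: frontier_def closure_closed)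
qed

section \<open>Minimality of the vertex half-spaces\<close>

lemma minimal_halfspaceI:
  assumes "I \<noteq> {}" "J \<noteq> {}" "I \<inter> J = {}" "trop_cone v \<subseteq> gen_halfspace a I J"
    and "\<And>b I' J'. I' \<noteq> {} \<Longrightarrow> I' \<inter> J' = {} \<Longrightarrow> trop_cone v \<subseteq> gen_halfspace b I' J' \<Longrightarrow>
      gen_halfspace b I' J' \<subseteq> gen_halfspace a I J \<Longrightarrow> gen_halfspace b I' J' = gen_halfspace a I J"
  shows "minimal_halfspace v (gen_halfspace a I J)"
  unfolding minimal_halfspace_def Let_def
proof (intro conjI ballI impI)
  fix H'
  assume sub: "H' \<subseteq> gen_halfspace a I J"
  assume "H' \<in> {H'. \<exists>a I J. I \<noteq> {} \<and> J \<noteq> {} \<and> I \<inter> J = {} \<and>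
    H' = gen_halfspace a I J \<and> trop_cone v \<subseteq> H'}"
  then obtain b I' J' where "I' \<noteq> {}" "I' \<inter> J' = {}" "H' = gen_halfspace b I' J'"
    "trop_cone v \<subseteq> H'"
    by (elim CollectE exE conjE)
  then show "H' = gen_halfspace a I J"
    using assms(5) sub by simp
next
  show "gen_halfspace a I J \<in> {H'. \<exists>a I J. I \<noteq> {} \<and> J \<noteq> {} \<and> I \<inter> J = {} \<and>
    H' = gen_halfspace a I J \<and> trop_cone v \<subseteq> H'}"
    using assms(1-4) by (intro CollectI exI[of _ a] exI[of _ I] exI[of _ J] conjI refl)
qed

text \<open>
  The supports are compared by testing on vectors with one or two finite entries, the apices by
  testing on generators.
\<close>

lemma vertex_halfspace_minimal:
  assumes vertex: "is_vertex v I j (proj a)" and j: "j \<notin> I"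
  shows "minimal_halfspace v (gen_halfspace a I (- I))"
proof -
  have I: "I \<noteq> {}"
    using vertex by (rule vertex_nonempty)
  have "gen_halfspace b I' J' = gen_halfspace a I (- I)"
    if I': "I' \<noteq> {}" and disj: "I' \<inter> J' = {}" and cone: "trop_cone v \<subseteq> gen_halfspace b I' J'"
      and sub: "gen_halfspace b I' J' \<subseteq> gen_halfspace a I (- I)" for b I' J'
  proof -
    have outside: "k \<in> I" if "k \<notin> J'" for k
    proof (rule ccontr)
      assume k: "k \<notin> I"
      \<comment> \<open>Only the inequality at \<open>k\<close> is not trivial for this vector, and
        \<open>k \<notin> J'\<close> removes it on the side of \<open>b\<close>.\<close>
      let ?x = "\<chi> i. if i = k then 0 else - (\<infinity> :: ereal)"
      have x: "?x \<in> rmax_vecs"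
        by (auto simp: rmax_vecs_def)
      have "?x \<in> gen_halfspace b I' J'"
        using I' \<open>k \<notin> J'\<close> by (auto simp: gen_halfspace_iff[OF I' x])
      then have "?x \<in> gen_halfspace a I (- I)"
        using sub by blast
      then obtain i where "i \<in> I" "?x $ k - ereal (a $ k) \<le> ?x $ i - ereal (a $ i)"
        using k unfolding gen_halfspace_iff[OF I x] by blast
      then show False
        using k by (auto split: if_splits)
    qed
    have D_ge: "b $ k - a $ k \<le> b $ i - a $ i" if i: "i \<in> I'" and k: "k \<notin> I" for i k
    proof -
      \<comment> \<open>The two finite entries tie relative to \<open>b\<close>, so \<open>i\<close>
        dominates \<open>k\<close> there; relative to \<open>a\<close> the entry at
        \<open>k \<notin> I\<close> can only be dominated by \<open>i\<close>.\<close>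
      let ?x = "\<chi> l. if l = k then ereal (b $ k) else if l = i then ereal (b $ i) else - (\<infinity> :: ereal)"
      have ik: "i \<noteq> k"
        using i k outside disj by auto
      have x: "?x \<in> rmax_vecs"
        by (auto simp: rmax_vecs_def)
      have "?x \<in> gen_halfspace b I' J'"
        using i ik by (auto simp: gen_halfspace_iff[OF I' x] intro!: bexI[of _ i])
      then have "?x \<in> gen_halfspace a I (- I)"
        using sub by blast
      then obtain m where "m \<in> I" "?x $ k - ereal (a $ k) \<le> ?x $ m - ereal (a $ m)"
        using k unfolding gen_halfspace_iff[OF I x] by blast
      then show ?thesis
        using k ik by (auto split: if_splits)
    qed
    have I_sub: "i \<in> I' \<and> b $ i - a $ i = b $ j - a $ j" if i: "i \<in> I" for i
    proof -
      \<comment> \<open>The (C4) generator for \<open>i\<close>: inside \<open>I\<close> only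
        \<open>i\<close> can balance its entry at \<open>j\<close>, so the index \<open>m\<close>
        supplied by the half-space at \<open>b\<close> must be \<open>i\<close>.\<close>
      obtain r where r: "\<And>l. v r $ l - a $ l \<le> v r $ j - a $ j"
        "\<And>k. k \<in> I - {i} \<Longrightarrow> v r $ k - a $ k < v r $ j - a $ j"
        using vertex i unfolding is_vertex_proj_iff by metis
      have "j \<in> J'"
        using outside j by auto
      then obtain m where m: "m \<in> I'" "v r $ j - b $ j \<le> v r $ m - b $ m"
        using cone trop_cone_subset_iff[OF I'] by metis
      have m': "m \<in> I"
        using m outside disj by blast
      have "b $ j - a $ j \<le> b $ m - a $ m"
        using m j by (intro D_ge)
      then have "m = i"
        using r(2)[of m] m m' by force
      then show ?thesis
        using m r(1)[of i] \<open>b $ j - a $ j \<le> b $ m - a $ m\<close> by auto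
    qed
    have eq: "I' = I" "J' = - I"
      using I_sub outside disj by auto
    have "b $ k - a $ k = b $ j - a $ j" for k
    proof (cases "k \<in> I")
      case False
      obtain i where i: "i \<in> I"
        using I by auto
      have "b $ k - a $ k \<le> b $ j - a $ j"
        using D_ge[of i k] I_sub[OF i] False by auto
      \<comment> \<open>(C2) gives a generator maximal at \<open>k\<close>; it yields the reverse of
        \<open>D_ge\<close>.\<close>
      obtain r where r: "\<And>l. v r $ l - a $ l \<le> v r $ k - a $ k"
        using vertex False unfolding is_vertex_proj_iff by metis
      obtain m where m: "m \<in> I" "v r $ k - b $ k \<le> v r $ m - b $ m"
        using cone trop_cone_subset_iff[OF I'] False eq by (metis ComplI)
      then show ?thesis
        using r[of m] I_sub[OF m(1)] \<open>b $ k - a $ k \<le> b $ j - a $ j\<close> by auto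
    qed (use I_sub in auto)
    then have "b $ k = b $ j - a $ j + a $ k" for k
      by (simp add: algebra_simps)
    then have "shift_equiv b a"
      unfolding shift_equiv_def by blast
    then show ?thesis
      using shift_equiv_gen_halfspace eq by blast
  qed
  then show ?thesis
    using I j trop_cone_subset_vertex_halfspace[OF vertex] by (intro minimal_halfspaceI) auto
qed

section \<open>Finiteness of the vertex set\<close>

definition vertices :: "('p::finite \<Rightarrow> real ^ 'n) \<Rightarrow> 'n trop_proj set" where
  "vertices v = {a. \<exists>I j. I \<noteq> {} \<and> I \<noteq> UNIV \<and> j \<notin> I \<and> is_vertex v I j a}"

text \<open>A vertex is determined by its type, and there are finitely many types. A generator
  shared by sectors \<open>i\<close> and \<open>k\<close> fixes the difference of these two
  coordinates; (C4) links \<open>I\<close> to \<open>j\<close>, and (C2) every other index to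
  \<open>I\<close>.\<close>

lemma finite_vertices: "finite (vertices v)"
proof (rule inj_on_finite[OF _ subset_UNIV finite])
  show "inj_on (type_sector v) (vertices v)"
  proof (rule inj_onI)
    fix p q
    assume "p \<in> vertices v"
      and type: "type_sector v p = type_sector v q"
    then obtain I j where vertex_p: "is_vertex v I j p"
      by (auto simp: vertices_def)
    obtain a where a: "p = proj a"
      by (rule proj_cases)
    obtain b where b: "q = proj b"
      by (rule proj_cases)
    have tight: "a $ k - b $ k = a $ i - b $ i"
      if "v r $ i - a $ i = v r $ k - a $ k" "\<And>l. v r $ l - a $ l \<le> v r $ k - a $ k" for r i k
    proof -
      have "r \<in> type_sector v p i" "r \<in> type_sector v p k"
        using that by (auto simp: a type_sector_proj)
      then have "r \<in> type_sector v q i" "r \<in> type_sector v q k"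
        by (simp_all add: type)
      then have "v r $ i - b $ i = v r $ k - b $ k"
        by (auto simp: b type_sector_proj intro: order_antisym)
      with that show ?thesis by simp
    qed
    have on_I: "a $ i - b $ i = a $ j - b $ j" if "i \<in> I" for i
      using vertex_p that tight[of _ i j] unfolding a is_vertex_proj_iff by metis
    have "a $ k - b $ k = a $ j - b $ j" for k
    proof (cases "k \<in> I")
      case False
      then obtain i where "i \<in> I" "a $ k - b $ k = a $ i - b $ i"
        using vertex_p tight unfolding a is_vertex_proj_iff by metis
      then show ?thesis
        using on_I by simp
    qed (rule on_I)
    then have "a $ k = a $ j - b $ j + b $ k" for k
      by (simp add: algebra_simps)
    then show "p = q"
      unfolding a b proj_eq_iff shift_equiv_def by blast
  qed
qed


section \<open>Separation by vertices\<close>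

text \<open>Lowers a valid inequality to a minimal one. In the application
  \<open>d r i = v r $ j - v r $ i\<close>, so \<open>d r i \<le> c i\<close> means that generator
  \<open>r\<close> satisfies the inequality through its term \<open>i\<close>, and
  \<open>P i t\<close> that threshold \<open>t\<close> keeps this term too small at the given point.
  The last conclusion makes each term critical for some generator, the source of (C4).\<close>

lemma minimal_threshold_cover:
  fixes d :: "'p::finite \<Rightarrow> 'n::finite \<Rightarrow> real"
  assumes cover: "\<And>r. \<exists>i. P i (d r i)"
    and down: "\<And>i s t. P i t \<Longrightarrow> s \<le> t \<Longrightarrow> P i s"
  obtains I c where "\<And>i. i \<in> I \<Longrightarrow> P i (c i)" "\<And>r. \<exists>i\<in>I. d r i \<le> c i"
    "\<And>i. i \<in> I \<Longrightarrow> \<exists>r. d r i = c i \<and> (\<forall>k\<in>I - {i}. c k < d r k)"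
proof -
  \<comment> \<open>Thresholds are represented by \<open>c i = d (s i) i\<close>, so there are finitely many candidates;
    lowering a threshold, or dropping an index, covers fewer pairs.\<close>
  define covered where
    "covered X = (case X of (I, s) \<Rightarrow> {(r, i). i \<in> I \<and> d r i \<le> d (s i) i})"
    for X :: "'n set \<times> ('n \<Rightarrow> 'p)"
  define good where
    "good X \<longleftrightarrow> (case X of (I, s) \<Rightarrow> (\<forall>i\<in>I. P i (d (s i) i)) \<and> (\<forall>r. \<exists>i\<in>I. d r i \<le> d (s i) i))"
    for X :: "'n set \<times> ('n \<Rightarrow> 'p)"
  \<comment> \<open>Starting candidate: every index with an admissible value \<open>d r i\<close>,
    each with the largest such value.\<close>
  let ?I = "{i. \<exists>r. P i (d r i)}"
  have "\<forall>i\<in>?I. \<exists>s. P i (d s i) \<and> (\<forall>r. P i (d r i) \<longrightarrow> d r i \<le> d s i)"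
  proof
    fix i
    assume "i \<in> ?I"
    then obtain s where "s \<in> {r. P i (d r i)}" "\<And>r. r \<in> {r. P i (d r i)} \<Longrightarrow> d r i \<le> d s i"
      using finite_argmax[of "{r. P i (d r i)}" "\<lambda>r. d r i"] by auto
    then show "\<exists>s. P i (d s i) \<and> (\<forall>r. P i (d r i) \<longrightarrow> d r i \<le> d s i)"
      by blast
  qed
  then obtain s where "\<forall>i\<in>?I. P i (d (s i) i) \<and> (\<forall>r. P i (d r i) \<longrightarrow> d r i \<le> d (s i) i)"
    by (rule bchoice[THEN exE])
  then have "good (?I, s)"
    unfolding good_def using cover by blast
  then obtain X where X: "good X" "\<And>Y. good Y \<Longrightarrow> card (covered X) \<le> card (covered Y)"
    using ex_has_least_nat[of good _ "\<lambda>X. card (covered X)"] by blast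
  obtain I s where Is: "X = (I, s)"
    by (cases X)
  have min: "\<not> good Y" if "covered Y \<subset> covered X" for Y
    using X(2)[of Y] psubset_card_mono[OF _ that] by (auto simp: leD)
  have P: "\<And>i. i \<in> I \<Longrightarrow> P i (d (s i) i)" and cov: "\<And>r. \<exists>i\<in>I. d r i \<le> d (s i) i"
    using X(1) by (auto simp: good_def Is)
  have "\<exists>r. d r i = d (s i) i \<and> (\<forall>k\<in>I - {i}. d (s k) k < d r k)" if i: "i \<in> I" for i
  proof (rule ccontr)
    assume "\<nexists>r. d r i = d (s i) i \<and> (\<forall>k\<in>I - {i}. d (s k) k < d r k)"
    then have lower: "d r i < d (s i) i \<or> (\<exists>k\<in>I - {i}. d r k \<le> d (s k) k)" for r
      using cov[of r] by (metis Diff_iff empty_iff insert_iff less_le not_le)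
    let ?L = "{r. d r i < d (s i) i}"
    show False
    proof (cases "?L = {}")
      case True
      have "good (I - {i}, s)"
        unfolding good_def using P lower True by auto
      moreover have "covered (I - {i}, s) \<subset> covered X"
        unfolding covered_def Is using i by auto
      ultimately show False
        using min by blast
    next
      case False
      then obtain m where m: "d m i < d (s i) i" "\<And>r. d r i < d (s i) i \<Longrightarrow> d r i \<le> d m i"
        using finite_argmax[of ?L "\<lambda>r. d r i"] by (metis finite_class.finite mem_Collect_eq)
      have "P k (d ((s(i := m)) k) k)" if "k \<in> I" for k
        using down[OF P[OF i]] m(1) P that by simp
      moreover have "\<exists>k\<in>I. d r k \<le> d ((s(i := m)) k) k" for r
      proof (cases "d r i < d (s i) i")
        case True
        then show ?thesis
          using m(2) i by (intro bexI[of _ i]) auto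
      next
        case False
        then obtain k where "k \<in> I - {i}" "d r k \<le> d (s k) k"
          using lower by blast
        then show ?thesis
          by (intro bexI[of _ k]) auto
      qed
      ultimately have "good (I, s(i := m))"
        unfolding good_def by blast
      moreover have "covered (I, s(i := m)) \<subset> covered X"
      proof (rule psubsetI)
        show "covered (I, s(i := m)) \<subseteq> covered X"
          using m(1) by (auto simp: covered_def Is split: if_splits)
        have "(s i, i) \<in> covered X - covered (I, s(i := m))"
          using m(1) i by (auto simp: covered_def Is)
        then show "covered (I, s(i := m)) \<noteq> covered X"
          by blast
      qed
      ultimately show False
        using min by blast
    qed
  qed
  with P cov show thesis
    by (rule that[of I "\<lambda>i. d (s i) i"])
qed

text \<open>A point outside the cone violates some inequality at a coordinate \<open>j\<close> that
  all generators satisfy. The minimal form of it, with thresholds \<open>c\<close>, is the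
  inequality at \<open>j\<close> of a vertex half-space whose apex is \<open>- c i\<close> on
  \<open>I\<close> and \<open>0\<close> at \<open>j\<close>.\<close>

lemma vertex_separation:
  assumes x: "x \<in> rmax_vecs" "x \<notin> trop_cone v"
  obtains a I j where "j \<notin> I" "is_vertex v I j (proj a)" "x \<notin> gen_halfspace a I (- I)"
proof -
  \<comment> \<open>An entry \<open>-\<infinity>\<close> serves as the index \<open>i\<close> for
    every generator; if all entries are finite, \<open>j\<close> is an index whose sector is
    empty.\<close>
  obtain j where j: "x $ j \<noteq> - \<infinity>" "\<And>r. \<exists>i. x $ i + ereal (v r $ j - v r $ i) < x $ j"
  proof (cases "\<exists>m. x $ m = - \<infinity>")
    case True
    then obtain m where m: "x $ m = - \<infinity>" by blast
    obtain j where j: "x $ j \<noteq> - \<infinity>"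
      using x by (auto simp: rmax_vecs_def)
    have "x $ m + ereal t < x $ j" for t
      using m j by simp
    with j that show thesis
      by blast
  next
    case False
    define y where "y = (\<chi> i. real_of_ereal (x $ i))"
    have "x $ i = ereal (y $ i)" for i
      using False x(1) by (cases "x $ i") (auto simp: y_def rmax_vecs_def)
    then have xy: "x = ereal_vec y"
      by (simp add: vec_eq_iff)
    then obtain j where j: "\<And>r. \<exists>i. v r $ j - y $ j < v r $ i - y $ i"
      using x by (auto simp: ereal_vec_in_trop_cone_iff not_le)
    have "\<exists>i. x $ i + ereal (v r $ j - v r $ i) < x $ j" for r
      using j[of r] by (auto simp: xy algebra_simps)
    then show thesis
      using that[of j] by (simp add: xy)
  qed
  obtain I c where Ic: "\<And>i. i \<in> I \<Longrightarrow> x $ i + ereal (c i) < x $ j"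
    and cov: "\<And>r. \<exists>i\<in>I. v r $ j - v r $ i \<le> c i"
    and tight: "\<And>i. i \<in> I \<Longrightarrow>
      \<exists>r. v r $ j - v r $ i = c i \<and> (\<forall>k\<in>I - {i}. c k < v r $ j - v r $ k)"
  proof (rule minimal_threshold_cover[of "\<lambda>i t. x $ i + ereal t < x $ j"
        "\<lambda>r i. v r $ j - v r $ i"])
    show "x $ i + ereal s < x $ j" if "x $ i + ereal t < x $ j" "s \<le> t" for i s t
      using that by (meson add_left_mono ereal_less_eq(3) le_less_trans)
  qed (use j(2) in auto)
  have I: "I \<noteq> {}"
    using cov by auto
  have jI: "j \<notin> I"
  proof
    assume "j \<in> I"
    from tight[OF this] have "c j = 0" by auto
    with Ic[OF \<open>j \<in> I\<close>] show False by simp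
  qed
  \<comment> \<open>The coordinates outside \<open>I\<close> are chosen smallest possible; for \<open>j\<close> this gives \<open>a\<^sub>j = 0\<close>.\<close>
  define M where "M r = Max ((\<lambda>i. v r $ i + c i) ` I)" for r
  have M_ge: "v r $ i + c i \<le> M r" if "i \<in> I" for r i
    unfolding M_def using that by (intro Max_ge) auto
  have M_attained: "\<exists>i\<in>I. M r = v r $ i + c i" for r
    using Max_in[of "(\<lambda>i. v r $ i + c i) ` I"] I unfolding M_def by fastforce
  define a where "a = (\<chi> k. if k \<in> I then - c k else Max (range (\<lambda>r. v r $ k - M r)))"
  have a_I: "a $ i = - c i" if "i \<in> I" for i
    using that by (simp add: a_def)
  have a_ge: "v r $ k - M r \<le> a $ k" if "k \<notin> I" for k r
    using that by (auto simp: a_def intro!: Max_ge)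
  have a_attained: "\<exists>r. a $ k = v r $ k - M r" if "k \<notin> I" for k
  proof -
    have "Max (range (\<lambda>r. v r $ k - M r)) \<in> range (\<lambda>r. v r $ k - M r)"
      by (intro Max_in) auto
    then obtain r where "Max (range (\<lambda>r. v r $ k - M r)) = v r $ k - M r"
      by (rule imageE)
    then show ?thesis
      using that by (auto simp: a_def)
  qed
  have le_M: "v r $ l - a $ l \<le> M r" for r l
    using a_ge[of l r] M_ge[of l r] a_I[of l] by (cases "l \<in> I") auto
  have j_le_M: "v r $ j \<le> M r" for r
    using cov[of r] M_ge[of _ r] by fastforce
  \<comment> \<open>For a generator critical at \<open>i\<close>, the other terms of the maximum
    stay below \<open>v r $ j\<close>, so \<open>M r\<close> is attained at \<open>i\<close> and
    ties with \<open>j\<close>.\<close>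
  have M_tight: "M r = v r $ j"
    if "i \<in> I" "v r $ j - v r $ i = c i" "\<forall>k\<in>I - {i}. c k < v r $ j - v r $ k" for i r
  proof -
    obtain m where m: "m \<in> I" "M r = v r $ m + c m"
      using M_attained by blast
    show ?thesis
    proof (cases "m = i")
      case False
      then have "c m < v r $ j - v r $ m"
        using that(3) m(1) by blast
      then show ?thesis
        using m(2) j_le_M[of r] by linarith
    qed (use m(2) that(2) in simp)
  qed
  have a_j: "a $ j = 0"
  proof (rule antisym)
    show "a $ j \<le> 0"
      using a_attained[OF jI] j_le_M by (metis diff_le_0_iff_le)
    obtain i where "i \<in> I" using I by auto
    then obtain r where "M r = v r $ j"
      using tight[of i] M_tight[of i] by blast
    then show "0 \<le> a $ j"
      using a_ge[OF jI, of r] by simp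
  qed
  \<comment> \<open>\<open>M r\<close> is the maximal entry of \<open>v r - a\<close>: (C1) comes
    from \<open>M_attained\<close>, (C2) from \<open>a_attained\<close> in addition, (C4) from
    \<open>tight\<close>.\<close>
  have "is_vertex v I j (proj a)"
    unfolding is_vertex_proj_iff
  proof (intro conjI allI impI ballI)
    fix r
    obtain i where "i \<in> I" "M r = v r $ i + c i"
      using M_attained by blast
    then show "\<exists>i\<in>I. \<forall>l. v r $ l - a $ l \<le> v r $ i - a $ i"
      using le_M[of r] a_I[of i] by (intro bexI[of _ i]) auto
  next
    fix k
    assume "k \<notin> I"
    then obtain r where r: "a $ k = v r $ k - M r"
      using a_attained by blast
    obtain i where "i \<in> I" "M r = v r $ i + c i"
      using M_attained by blast
    then show "\<exists>i\<in>I. \<exists>r. v r $ i - a $ i = v r $ k - a $ k \<and>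
        (\<forall>l. v r $ l - a $ l \<le> v r $ k - a $ k)"
      using le_M[of r] a_I[of i] r by (intro bexI[of _ i] exI[of _ r]) auto
  next
    fix i
    assume i: "i \<in> I"
    then obtain r where r: "v r $ j - v r $ i = c i" "\<forall>k\<in>I - {i}. c k < v r $ j - v r $ k"
      using tight by blast
    then show "\<exists>r. v r $ i - a $ i = v r $ j - a $ j \<and> (\<forall>l. v r $ l - a $ l \<le> v r $ j - a $ j) \<and>
        (\<forall>k\<in>I - {i}. v r $ k - a $ k < v r $ j - a $ j)"
      using le_M[of r] M_tight[OF i r] a_I a_j i by (intro exI[of _ r]) (auto simp: algebra_simps)
  qed
  moreover have "x \<notin> gen_halfspace a I (- I)"
  proof
    assume "x \<in> gen_halfspace a I (- I)"
    then obtain i where i: "i \<in> I" "x $ j - ereal (a $ j) \<le> x $ i - ereal (a $ i)"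
      using jI by (auto simp: gen_halfspace_iff[OF I x(1)])
    then have "x $ j \<le> x $ i + ereal (c i)"
      by (simp add: a_j a_I minus_ereal_def zero_ereal_def[symmetric])
    with Ic[OF i(1)] show False by simp
  qed
  ultimately show thesis
    using that jI by blast
qed


section \<open>Generic extremities\<close>

text \<open>
  The ball with centre \<open>z\<close> and radius \<open>R\<close> is generated by the points \<open>z + R e\<^sub>k\<close>; a half-space
  containing it contains the points with \<open>k \<notin> K\<close>, so \<open>z\<close> satisfies the inequality with margin \<open>R\<close>.
\<close>

lemma generic_extremities_margin:
  assumes "generic_extremities v"
  obtains z R where "R > 0" "\<And>i l. v r $ i - z $ i - (v r $ l - z $ l) \<le> R"
    "\<And>a K k. K \<noteq> {} \<Longrightarrow> trop_cone v \<subseteq> gen_halfspace a K (- K) \<Longrightarrow> k \<notin> K \<Longrightarrow>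
       \<exists>i\<in>K. z $ k - a $ k + R \<le> z $ i - a $ i"
proof -
  obtain p R where R: "R > 0" "proj (v r) \<in> cball p R" "cball p R \<subseteq> proj_cone v"
    using assms unfolding generic_extremities_def by blast
  obtain z where z: "p = proj z"
    by (rule proj_cases)
  have margin: "\<exists>i\<in>K. z $ k - a $ k + R \<le> z $ i - a $ i"
    if K: "K \<noteq> {}" "trop_cone v \<subseteq> gen_halfspace a K (- K)" "k \<notin> K" for a K k
  proof -
    let ?y = "z + axis k R"
    obtain i l where "hilbert_dist z ?y = z $ i - ?y $ i - (z $ l - ?y $ l)"
      by (rule hilbert_dist_attained)
    then have "dist (proj z) (proj ?y) \<le> R"
      using R(1) by (auto simp: dist_trop_proj.abs_eq axis_def)
    then have "ereal_vec ?y \<in> trop_cone v"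
      using R(3) by (auto simp: z proj_in_proj_cone_iff)
    then have "ereal_vec ?y \<in> gen_halfspace a K (- K)"
      using K(2) by blast
    then obtain i where "i \<in> K" "?y $ k - a $ k \<le> ?y $ i - a $ i"
      using K(3) unfolding ereal_vec_in_gen_halfspace_iff[OF K(1)] by blast
    then show ?thesis
      using K(3) by (intro bexI[of _ i]) (auto simp: axis_def split: if_splits)
  qed
  have "dist (proj (v r)) (proj z) \<le> R"
    using R(2) by (simp add: z dist_commute)
  then have "v r $ i - z $ i - (v r $ l - z $ l) \<le> R" for i l
    using hilbert_dist_upper[of "v r" i z l] by (simp add: dist_trop_proj.abs_eq)
  with R(1) show thesis
    using margin by (rule that)
qed

text \<open>At the centre \<open>z\<close> of the ball for \<open>v r\<close>, the maximal entry of
  \<open>z - a\<close> exceeds every entry outside \<open>K\<close> or outside \<open>L\<close> by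
  at least \<open>R\<close>, so its index \<open>t\<close> lies in both. The generator is close
  enough to \<open>z\<close> that \<open>t\<close> still dominates these entries.\<close>

lemma trop_cone_subset_halfspace_Int:
  assumes generic: "generic_extremities v"
    and K: "K \<noteq> {}" "trop_cone v \<subseteq> gen_halfspace a K (- K)"
    and L: "L \<noteq> {}" "trop_cone v \<subseteq> gen_halfspace a L (- L)"
  shows "K \<inter> L \<noteq> {}" "trop_cone v \<subseteq> gen_halfspace a (K \<inter> L) (- (K \<inter> L))"
proof -
  have key: "\<exists>t\<in>K \<inter> L. \<forall>l. l \<notin> K \<inter> L \<longrightarrow> v r $ l - a $ l \<le> v r $ t - a $ t" for r
  proof -
    obtain z R where R: "R > 0" "\<And>i l. v r $ i - z $ i - (v r $ l - z $ l) \<le> R"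
      and margin: "\<And>a K k. K \<noteq> {} \<Longrightarrow> trop_cone v \<subseteq> gen_halfspace a K (- K) \<Longrightarrow> k \<notin> K \<Longrightarrow>
         \<exists>i\<in>K. z $ k - a $ k + R \<le> z $ i - a $ i"
      using generic_extremities_margin[OF generic, of r] by metis
    obtain t where t: "\<And>l. z $ l - a $ l \<le> z $ t - a $ t"
      using finite_argmax[of UNIV "\<lambda>l. z $ l - a $ l"] by (metis UNIV_I UNIV_not_empty finite)
    have gap: "z $ l - a $ l + R \<le> z $ t - a $ t" if "l \<notin> K \<inter> L" for l
      using that margin[OF K, of l] margin[OF L, of l] t by (meson IntI order_trans)
    have "t \<in> K \<inter> L"
      using gap[of t] R(1) by force
    moreover have "v r $ l - a $ l \<le> v r $ t - a $ t" if "l \<notin> K \<inter> L" for l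
      using gap[OF that] R(2)[of l t] by linarith
    ultimately show ?thesis by blast
  qed
  then show nonempty: "K \<inter> L \<noteq> {}" by blast
  show "trop_cone v \<subseteq> gen_halfspace a (K \<inter> L) (- (K \<inter> L))"
    unfolding trop_cone_subset_iff[OF nonempty] using key by (metis ComplD)
qed

text \<open>By intersecting, the support may be taken inside \<open>I\<close>. The (C4) generator of
  \<open>i\<close> has its entry at \<open>j\<close> matched inside \<open>I\<close> only at
  \<open>i\<close>, so a support omitting \<open>i\<close> is impossible.\<close>

lemma vertex_subset_support:
  assumes generic: "generic_extremities v" and vertex: "is_vertex v I j (proj a)" and j: "j \<notin> I"
    and K: "K \<noteq> {}" "trop_cone v \<subseteq> gen_halfspace a K (- K)"
  shows "I \<subseteq> K"
proof
  fix i
  assume i: "i \<in> I"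
  have KI: "K \<inter> I \<noteq> {}" "trop_cone v \<subseteq> gen_halfspace a (K \<inter> I) (- (K \<inter> I))"
    using trop_cone_subset_halfspace_Int[OF generic K vertex_nonempty[OF vertex]
        trop_cone_subset_vertex_halfspace[OF vertex]] by blast+
  obtain r where r: "\<And>k. k \<in> I - {i} \<Longrightarrow> v r $ k - a $ k < v r $ j - a $ j"
    using vertex i unfolding is_vertex_proj_iff by metis
  obtain k where "k \<in> K \<inter> I" "v r $ j - a $ j \<le> v r $ k - a $ k"
    using KI(2) j unfolding trop_cone_subset_iff[OF KI(1)] by blast
  with r[of k] show "i \<in> K"
    by (cases "k = i") auto
qed

lemma vertex_support_unique:
  assumes "generic_extremities v" "is_vertex v I j (proj a)" "j \<notin> I"
    "is_vertex v I' j' (proj a)" "j' \<notin> I'"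
  shows "I = I'"
proof
  show "I \<subseteq> I'"
    using assms(4) by (intro vertex_subset_support[OF assms(1-3)] vertex_nonempty
      trop_cone_subset_vertex_halfspace)
  show "I' \<subseteq> I"
    using assms(2) by (intro vertex_subset_support[OF assms(1,4,5)] vertex_nonempty
      trop_cone_subset_vertex_halfspace)
qed

text \<open>
  For the generator \<open>r\<close> witnessing condition (C4) at \<open>i\<close>, the centre of its ball has its largest
  \<open>a\<close>-coordinate only at \<open>i\<close>, exceeding the \<open>j\<close>-th by \<open>R\<close>; the margin at \<open>c\<close> then forces \<open>i\<close> to
  attain the maximum of \<open>a - c\<close>.
\<close>

lemma vertex_apex_eq:
  assumes generic: "generic_extremities v" and vertex: "is_vertex v I j (proj a)" and j: "j \<notin> I"
    and c: "ereal_vec c \<in> trop_cone v"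
    and K: "K \<noteq> {}" "trop_cone v \<subseteq> gen_halfspace c K (- K)" "j \<notin> K"
    and max: "\<And>l. a $ l - c $ l \<le> a $ j - c $ j"
  shows "shift_equiv a c"
proof -
  have I: "I \<noteq> {}" "trop_cone v \<subseteq> gen_halfspace a I (- I)"
    using vertex_nonempty[OF vertex] trop_cone_subset_vertex_halfspace[OF vertex] .
  have on_I: "a $ i - c $ i = a $ j - c $ j" if i: "i \<in> I" for i
  proof -
    obtain r where r: "v r $ i - a $ i = v r $ j - a $ j"
      "\<And>k. k \<in> I - {i} \<Longrightarrow> v r $ k - a $ k < v r $ j - a $ j"
      using vertex i unfolding is_vertex_proj_iff by metis
    obtain z R where R: "R > 0" "\<And>i l. v r $ i - z $ i - (v r $ l - z $ l) \<le> R"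
      and margin: "\<And>a K k. K \<noteq> {} \<Longrightarrow> trop_cone v \<subseteq> gen_halfspace a K (- K) \<Longrightarrow> k \<notin> K \<Longrightarrow>
         \<exists>i\<in>K. z $ k - a $ k + R \<le> z $ i - a $ i"
      using generic_extremities_margin[OF generic, of r] by metis
    have below: "z $ k - a $ k < z $ j - a $ j + R" if "k \<noteq> i" for k
    proof -
      have in_I: "z $ l - a $ l < z $ j - a $ j + R" if "l \<in> I - {i}" for l
        using r(2)[OF that] R(2)[of j l] by linarith
      have i_le: "z $ i - a $ i \<le> z $ j - a $ j + R"
        using r(1) R(2)[of j i] by linarith
      show ?thesis
      proof (cases "k \<in> I")
        case True
        then show ?thesis
          using in_I that by auto
      next
        case False
        then obtain l where "l \<in> I" "z $ k - a $ k + R \<le> z $ l - a $ l"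
          using margin[OF I] by blast
        then show ?thesis
          using in_I[of l] i_le R(1) by (cases "l = i") auto
      qed
    qed
    \<comment> \<open>As \<open>a - c\<close> is largest at \<open>j\<close>, the margin relative to
      \<open>c\<close> carries over to \<open>a\<close>, and \<open>below\<close> leaves only
      \<open>m = i\<close>.\<close>
    obtain m where m: "z $ j - c $ j + R \<le> z $ m - c $ m"
      using margin[OF K] by blast
    then have "m = i"
      using below[of m] max[of m] by linarith
    have "z $ i - a $ i \<le> z $ j - a $ j + R"
      using r(1) R(2)[of j i] by linarith
    then show ?thesis
      using m max[of i] unfolding \<open>m = i\<close> by linarith
  qed
  have "a $ k - c $ k = a $ j - c $ j" for k
  proof (cases "k \<in> I")
    case False
    \<comment> \<open>Sector \<open>k\<close> of \<open>c\<close> is non-empty because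
      \<open>c\<close> lies in the cone; comparison with (C1) at \<open>a\<close> bounds
      \<open>a $ k - c $ k\<close> from below.\<close>
    obtain r where r: "\<And>i. v r $ i - c $ i \<le> v r $ k - c $ k"
      using c by (auto simp: ereal_vec_in_trop_cone_iff)
    obtain i where i: "i \<in> I" "v r $ k - a $ k \<le> v r $ i - a $ i"
      using vertex unfolding is_vertex_proj_iff by blast
    then show ?thesis
      using r[of i] on_I[of i] max[of k] by linarith
  qed (rule on_I)
  then have "a $ k = a $ j - c $ j + c $ k" for k
    by (simp add: algebra_simps)
  then show ?thesis
    unfolding shift_equiv_def by blast
qed

text \<open>Raising entry \<open>j\<close> could violate an inequality at once only if
  \<open>j \<notin> K\<close> and \<open>j\<close> already attains the maximum of
  \<open>a - c\<close>; \<open>vertex_apex_eq\<close> then forces the apices to coincide.\<close>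

lemma vertex_perturbation_in_halfspace:
  assumes generic: "generic_extremities v" and vertex: "is_vertex v I j (proj a)" and j: "j \<notin> I"
    and c: "ereal_vec c \<in> trop_cone v" "proj c \<noteq> proj a"
    and K: "K \<noteq> {}" "trop_cone v \<subseteq> gen_halfspace c K (- K)"
  shows "\<forall>\<^sub>F e in at_right 0. ereal_vec (a + axis j e) \<in> gen_halfspace c K (- K)"
proof -
  obtain i where i: "i \<in> K" "\<And>l. l \<in> K \<Longrightarrow> a $ l - c $ l \<le> a $ i - c $ i"
    using finite_argmax[of K "\<lambda>l. a $ l - c $ l"] K(1) by (metis finite)
  have "ereal_vec a \<in> gen_halfspace c K (- K)"
    using vertex_in_trop_cone[OF vertex] K(2) by blast
  then have i_max: "a $ l - c $ l \<le> a $ i - c $ i" for l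
    using i(2) unfolding ereal_vec_in_gen_halfspace_iff[OF K(1)] by (meson ComplI order_trans)
  have gap: "j \<in> K \<or> a $ j - c $ j < a $ i - c $ i"
  proof (rule ccontr)
    assume "\<not> ?thesis"
    then have "shift_equiv a c"
      using order_trans[OF i_max] by (intro vertex_apex_eq[OF generic vertex j c(1) K]) auto
    then show False
      using c(2) by (metis proj_eq_iff)
  qed
  \<comment> \<open>For \<open>j \<in> K\<close> every step size is harmless and \<open>1\<close> is
    arbitrary; otherwise \<open>e0\<close> is the slack at \<open>j\<close>.\<close>
  define e0 where "e0 = (if j \<in> K then 1 else a $ i - c $ i - (a $ j - c $ j))"
  have "e0 > 0"
    using gap by (auto simp: e0_def)
  moreover have "ereal_vec (a + axis j e) \<in> gen_halfspace c K (- K)" if e: "0 < e" "e < e0" for e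
    unfolding ereal_vec_in_gen_halfspace_iff[OF K(1)]
  proof
    fix l
    assume "l \<in> - K"
    then have "(a + axis j e) $ l - c $ l \<le> (a + axis j e) $ i - c $ i"
      using e i_max[of l] i(1) by (auto simp: axis_def e0_def split: if_splits)
    then show "\<exists>i\<in>K. (a + axis j e) $ l - c $ l \<le> (a + axis j e) $ i - c $ i"
      using i(1) by blast
  qed
  ultimately show ?thesis
    unfolding eventually_at_right_field by blast
qed

text \<open>Finitely many half-spaces with other apices admit a common small \<open>e\<close>: the
  point \<open>a' + axis j e\<close> lies in all of them and outside the half-space at
  \<open>a\<close>.\<close>

lemma vertex_halfspace_not_implied:
  assumes generic: "generic_extremities v" and vertex: "is_vertex v I j a" and j: "j \<notin> I"
    and \<Gamma>: "finite \<Gamma>" "\<And>H. H \<in> \<Gamma> \<Longrightarrow> \<exists>c\<in>proj_cone v - {a}. H \<in> halfspaces_at v c"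
  shows "\<not> inter_halfspaces \<Gamma> \<subseteq> halfspace a I"
proof -
  obtain a' where a: "a = proj a'"
    by (rule proj_cases)
  have vertex': "is_vertex v I j (proj a')"
    using vertex by (simp add: a)
  have "\<forall>\<^sub>F e in at_right 0. ereal_vec (a' + axis j e) \<in> H" if H: "H \<in> \<Gamma>" for H
  proof -
    obtain p where p: "p \<in> proj_cone v" "p \<noteq> a" "H \<in> halfspaces_at v p"
      using \<Gamma>(2)[OF H] by blast
    obtain c where c: "p = proj c"
      by (rule proj_cases)
    show ?thesis
      using p vertex_perturbation_in_halfspace[OF generic vertex' j]
      by (auto simp: c a halfspaces_at_proj proj_in_proj_cone_iff)
  qed
  then have "\<forall>\<^sub>F e in at_right 0. \<forall>H\<in>\<Gamma>. ereal_vec (a' + axis j e) \<in> H"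
    using \<Gamma>(1) by (simp add: eventually_ball_finite)
  then have "\<forall>\<^sub>F e in at_right (0::real). 0 < e \<and> (\<forall>H\<in>\<Gamma>. ereal_vec (a' + axis j e) \<in> H)"
    using eventually_at_right_less[of "0::real"] by (rule eventually_conj[rotated])
  then obtain e :: real where "0 < e" "\<forall>H\<in>\<Gamma>. ereal_vec (a' + axis j e) \<in> H"
    using eventually_happens'[OF trivial_limit_at_right_real] by blast
  then show ?thesis
    using vertex_perturbation_notin[OF vertex' j, of e]
    unfolding inter_halfspaces_def a halfspace_proj using ereal_vec_in_rmax_vecs by blast
qed


section \<open>The external representation by vertices\<close>

definition vertex_halfspaces :: "('p::finite \<Rightarrow> real ^ 'n) \<Rightarrow> (ereal ^ 'n) set set" where
  "vertex_halfspaces v =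
     {halfspace a I | a I j. I \<noteq> {} \<and> I \<noteq> UNIV \<and> j \<notin> I \<and> is_vertex v I j a}"

lemma vertex_halfspace_in_halfspaces_at:
  assumes "is_vertex v I j a" "j \<notin> I"
  shows "halfspace a I \<in> halfspaces_at v a"
proof -
  obtain a' where a: "a = proj a'"
    by (rule proj_cases)
  have vertex: "is_vertex v I j (proj a')"
    using assms(1) by (simp add: a)
  show ?thesis
    using vertex_nonempty[OF vertex] trop_cone_subset_vertex_halfspace[OF vertex] assms(2)
    unfolding a halfspaces_at_proj halfspace_proj by blast
qed

lemma finite_halfspaces_at: "finite (halfspaces_at v b)"
proof -
  have "halfspaces_at v b \<subseteq> range (halfspace b)"
    by (auto simp: halfspaces_at_def)
  then show ?thesis
    by (rule finite_subset) simp
qed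

lemma halfspaces_at_D:
  assumes "H \<in> halfspaces_at v b"
  shows "trop_cone v \<subseteq> H" "\<not> rmax_vecs \<subseteq> H"
proof -
  obtain b' where "b = proj b'"
    by (rule proj_cases)
  with assms show "trop_cone v \<subseteq> H" "\<not> rmax_vecs \<subseteq> H"
    using rmax_vecs_not_subset_gen_halfspace by (auto simp: halfspaces_at_proj)
qed

lemma vertices_subset_frontier: "vertices v \<subseteq> frontier (proj_cone v)"
proof
  fix a
  assume "a \<in> vertices v"
  moreover obtain a' where "a = proj a'"
    by (rule proj_cases)
  ultimately show "a \<in> frontier (proj_cone v)"
    unfolding vertices_def using vertex_in_frontier by blast
qed

lemma frontier_subset_proj_cone: "frontier (proj_cone v) \<subseteq> proj_cone v"
  using closed_proj_cone by (rule frontier_subset_closed)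

lemma vertex_halfspaces_subset: "vertex_halfspaces v \<subseteq> (\<Union>c\<in>vertices v. halfspaces_at v c)"
proof
  fix H
  assume "H \<in> vertex_halfspaces v"
  then obtain a I j where "H = halfspace a I" "I \<noteq> {}" "I \<noteq> UNIV" "j \<notin> I" "is_vertex v I j a"
    unfolding vertex_halfspaces_def by blast
  then have "a \<in> vertices v" "H \<in> halfspaces_at v a"
    using vertex_halfspace_in_halfspaces_at by (auto simp: vertices_def)
  then show "H \<in> (\<Union>c\<in>vertices v. halfspaces_at v c)"
    by blast
qed

lemma inter_halfspaces_mono: "\<Gamma> \<subseteq> \<Delta> \<Longrightarrow> inter_halfspaces \<Delta> \<subseteq> inter_halfspaces \<Gamma>"
  by (auto simp: inter_halfspaces_def)

lemma inter_vertex_halfspaces: "inter_halfspaces (vertex_halfspaces v) = trop_cone v"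
proof
  show "inter_halfspaces (vertex_halfspaces v) \<subseteq> trop_cone v"
  proof
    fix x
    assume x: "x \<in> inter_halfspaces (vertex_halfspaces v)"
    show "x \<in> trop_cone v"
    proof (rule ccontr)
      assume "x \<notin> trop_cone v"
      moreover have "x \<in> rmax_vecs"
        using x by (simp add: inter_halfspaces_def)
      ultimately obtain a I j where
        sep: "j \<notin> I" "is_vertex v I j (proj a)" "x \<notin> gen_halfspace a I (- I)"
        using vertex_separation by metis
      then have "halfspace (proj a) I \<in> vertex_halfspaces v"
        using vertex_nonempty[OF sep(2)] unfolding vertex_halfspaces_def by blast
      with x sep(3) show False
        by (auto simp: inter_halfspaces_def halfspace_proj)
    qed
  qed
  show "trop_cone v \<subseteq> inter_halfspaces (vertex_halfspaces v)"
  proof -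
    have "trop_cone v \<subseteq> H" if "H \<in> vertex_halfspaces v" for H
      using that vertex_halfspaces_subset[of v] halfspaces_at_D(1) by blast
    then show ?thesis
      using trop_cone_subset_rmax_vecs[of v] unfolding inter_halfspaces_def by blast
  qed
qed

lemma spanning_apices_vertices: "spanning_apices v (vertices v)"
proof -
  let ?\<Gamma> = "\<Union>c\<in>vertices v. halfspaces_at v c"
  have inter: "inter_halfspaces ?\<Gamma> \<subseteq> trop_cone v"
    using inter_halfspaces_mono[OF vertex_halfspaces_subset] inter_vertex_halfspaces by blast
  have "H \<in> tau v ?\<Gamma>" if b: "b \<in> frontier (proj_cone v)" and H: "H \<in> halfspaces_at v b" for b H
  proof -
    have "inter_halfspaces ?\<Gamma> \<subseteq> H"
      using inter halfspaces_at_D(1)[OF H] by blast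
    \<comment> \<open>\<open>tau\<close> gives nothing on \<open>{}\<close>; an empty family would
      here mean \<open>rmax_vecs \<subseteq> H\<close>.\<close>
    moreover from this have "?\<Gamma> \<noteq> {}"
      using halfspaces_at_D(2)[OF H] by (metis Inf_empty inf_top_right inter_halfspaces_def)
    moreover have "H \<in> halfspaces_of v"
      using b H frontier_subset_proj_cone by (auto simp: halfspaces_of_def)
    ultimately show ?thesis
      by (simp add: tau_def)
  qed
  then have "tau' v (vertices v) = frontier (proj_cone v)"
    by (auto simp: tau'_def)
  then show ?thesis
    by (simp add: spanning_apices_def finite_vertices vertices_subset_frontier)
qed

text \<open>With \<open>spanning_apices_vertices\<close> this makes \<open>vertices v\<close> the
  least spanning set, hence the only minimal one. If \<open>a\<close> were missing, the half-spaces
  at the points of \<open>Y\<close> could not imply the one at \<open>a\<close>.\<close>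

lemma vertices_subset_spanning_apices:
  assumes generic: "generic_extremities v" and Y: "spanning_apices v Y"
  shows "vertices v \<subseteq> Y"
proof (rule subsetI, rule ccontr)
  fix a
  assume a: "a \<in> vertices v" and "a \<notin> Y"
  obtain I j where vertex: "j \<notin> I" "is_vertex v I j a"
    using a by (auto simp: vertices_def)
  let ?\<Gamma> = "\<Union>c\<in>Y. halfspaces_at v c"
  have "a \<in> tau' v Y"
    using a Y vertices_subset_frontier by (auto simp: spanning_apices_def)
  then have "halfspace a I \<in> tau v ?\<Gamma>"
    using vertex_halfspace_in_halfspaces_at[OF vertex(2,1)] by (auto simp: tau'_def)
  then have "inter_halfspaces ?\<Gamma> \<subseteq> halfspace a I"
    by (auto simp: tau_def split: if_splits)
  moreover have "\<not> inter_halfspaces ?\<Gamma> \<subseteq> halfspace a I"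
  proof (rule vertex_halfspace_not_implied[OF generic vertex(2,1)])
    show "finite ?\<Gamma>"
      using Y by (auto simp: spanning_apices_def finite_halfspaces_at)
    show "\<exists>c\<in>proj_cone v - {a}. H \<in> halfspaces_at v c" if "H \<in> ?\<Gamma>" for H
      using that Y \<open>a \<notin> Y\<close> frontier_subset_proj_cone by (fastforce simp: spanning_apices_def)
  qed
  ultimately show False by blast
qed

lemma nonredundant_apices_vertices:
  assumes "generic_extremities v"
  shows "nonredundant_apices v (vertices v)"
  unfolding nonredundant_apices_def minimal_spanning_apices_def
  using spanning_apices_vertices vertices_subset_spanning_apices[OF assms] by blast

lemma minimal_vertex_halfspaces:
  assumes "H \<in> vertex_halfspaces v"
  shows "minimal_halfspace v H"
proof -
  obtain a I j where "H = halfspace a I" "j \<notin> I" "is_vertex v I j a"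
    using assms unfolding vertex_halfspaces_def by blast
  moreover obtain a' where "a = proj a'"
    by (rule proj_cases)
  ultimately show ?thesis
    using vertex_halfspace_minimal by (auto simp: halfspace_proj)
qed

text \<open>Distinct vertex half-spaces have distinct apices, since a vertex determines its support;
  so none is implied by the others.\<close>

lemma nonredundant_ext_rep_vertex_halfspaces:
  assumes generic: "generic_extremities v"
  shows "nonredundant_ext_rep v (vertex_halfspaces v)"
proof -
  have "finite (\<Union>c\<in>vertices v. halfspaces_at v c)"
    by (simp add: finite_vertices finite_halfspaces_at)
  then have finite: "finite (vertex_halfspaces v)"
    using vertex_halfspaces_subset by (rule finite_subset[rotated])
  have vertices_sub: "vertices v \<subseteq> proj_cone v"
    using vertices_subset_frontier frontier_subset_proj_cone by blast
  have "H \<notin> tau v (vertex_halfspaces v - {H})" if in_vertex: "H \<in> vertex_halfspaces v" for H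
  proof -
    obtain a I j where H: "H = halfspace a I" "j \<notin> I" "is_vertex v I j a"
      using in_vertex unfolding vertex_halfspaces_def by blast
    have "\<not> inter_halfspaces (vertex_halfspaces v - {H}) \<subseteq> halfspace a I"
    proof (rule vertex_halfspace_not_implied[OF generic H(3,2)])
      show "finite (vertex_halfspaces v - {H})"
        using finite by simp
      fix H'
      assume H': "H' \<in> vertex_halfspaces v - {H}"
      then obtain c K k where c: "H' = halfspace c K" "K \<noteq> {}" "K \<noteq> UNIV" "k \<notin> K" "is_vertex v K k c"
        unfolding vertex_halfspaces_def by blast
      obtain a' where a': "a = proj a'"
        by (rule proj_cases)
      have "c \<noteq> a"
        using vertex_support_unique[OF generic, of I j a' K k] H c H' by (auto simp: a')
      moreover have "c \<in> vertices v"
        using c by (auto simp: vertices_def)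
      ultimately show "\<exists>c\<in>proj_cone v - {a}. H' \<in> halfspaces_at v c"
        using vertex_halfspace_in_halfspaces_at[OF c(5,4)] vertices_sub c(1) by blast
    qed
    then show ?thesis
      by (auto simp: tau_def H(1))
  qed
  moreover have "vertex_halfspaces v \<subseteq> halfspaces_of v"
    using vertex_halfspaces_subset vertices_sub unfolding halfspaces_of_def by blast
  ultimately show ?thesis
    using finite by (simp add: nonredundant_ext_rep_def inter_vertex_halfspaces)
qed

text \<open>At each vertex \<open>a\<close> some member of \<open>\<Gamma>\<close> has apex
  \<open>a\<close>. Its support contains \<open>I\<close>, so it contains the vertex half-space, and
  its minimality forces equality.\<close>

lemma nonredundant_ext_rep_minimal_eq:
  assumes generic: "generic_extremities v" and rep: "nonredundant_ext_rep v \<Gamma>"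
    and minimal: "\<And>H. H \<in> \<Gamma> \<Longrightarrow> minimal_halfspace v H"
  shows "\<Gamma> = vertex_halfspaces v"
proof
  have \<Gamma>: "finite \<Gamma>" "\<Gamma> \<subseteq> halfspaces_of v" "inter_halfspaces \<Gamma> = trop_cone v"
    "\<And>H. H \<in> \<Gamma> \<Longrightarrow> H \<notin> tau v (\<Gamma> - {H})"
    using rep by (auto simp: nonredundant_ext_rep_def)
  show sub: "vertex_halfspaces v \<subseteq> \<Gamma>"
  proof
    fix H
    assume H_vertex: "H \<in> vertex_halfspaces v"
    then obtain a I j where H: "H = halfspace a I" "I \<noteq> UNIV" "j \<notin> I" "is_vertex v I j a"
      unfolding vertex_halfspaces_def by blast
    obtain a' where a': "a = proj a'"
      by (rule proj_cases)
    have vertex: "is_vertex v I j (proj a')"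
      using H(4) by (simp add: a')
    have "inter_halfspaces \<Gamma> \<subseteq> halfspace a I"
      using \<Gamma>(3) trop_cone_subset_vertex_halfspace[OF vertex] by (simp add: a' halfspace_proj)
    then have "\<not> (\<forall>H\<in>\<Gamma>. \<exists>c\<in>proj_cone v - {a}. H \<in> halfspaces_at v c)"
      using vertex_halfspace_not_implied[OF generic H(4,3) \<Gamma>(1)] by blast
    then obtain H' where H': "H' \<in> \<Gamma>" "H' \<in> halfspaces_at v a"
      using \<Gamma>(2) by (auto simp: halfspaces_of_def)
    then obtain K where K: "H' = gen_halfspace a' K (- K)" "K \<noteq> {}" "trop_cone v \<subseteq> H'"
      by (auto simp: a' halfspaces_at_proj)
    have IK: "I \<subseteq> K"
      using vertex_subset_support[OF generic vertex H(3) K(2)] K by simp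
    have I: "I \<noteq> {}"
      using vertex by (rule vertex_nonempty)
    have "H \<subseteq> H'"
      unfolding H(1) a' halfspace_proj K(1)
    proof
      fix x
      assume x: "x \<in> gen_halfspace a' I (- I)"
      then have "x \<in> rmax_vecs"
        by (simp add: gen_halfspace_def)
      with x IK show "x \<in> gen_halfspace a' K (- K)"
        unfolding gen_halfspace_iff[OF I \<open>x \<in> rmax_vecs\<close>] gen_halfspace_iff[OF K(2) \<open>x \<in> rmax_vecs\<close>]
        by blast
    qed
    moreover have "minimal_halfspace v H" "minimal_halfspace v H'"
      using minimal_vertex_halfspaces[OF H_vertex] minimal[OF H'(1)] .
    ultimately have "H = H'"
      unfolding minimal_halfspace_def Let_def by blast
    with H' show "H \<in> \<Gamma>" by simp
  qed
  show "\<Gamma> \<subseteq> vertex_halfspaces v"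
  proof (rule subsetI, rule ccontr)
    fix H
    assume H: "H \<in> \<Gamma>" "H \<notin> vertex_halfspaces v"
    then obtain b where b: "H \<in> halfspaces_at v b"
      using \<Gamma>(2) by (auto simp: halfspaces_of_def)
    \<comment> \<open>Without \<open>H\<close> the family still contains all vertex half-spaces and
      cuts out the cone, so \<open>H\<close> would be redundant.\<close>
    have "vertex_halfspaces v \<subseteq> \<Gamma> - {H}"
      using sub H by blast
    then have inter: "inter_halfspaces (\<Gamma> - {H}) \<subseteq> H"
      using inter_halfspaces_mono inter_vertex_halfspaces halfspaces_at_D(1)[OF b] by blast
    then have "\<Gamma> - {H} \<noteq> {}"
      using halfspaces_at_D(2)[OF b] by (metis Inf_empty inf_top_right inter_halfspaces_def)
    then have "H \<in> tau v (\<Gamma> - {H})"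
      using inter H(1) \<Gamma>(2) by (auto simp: tau_def)
    with \<Gamma>(4) H(1) show False by blast
  qed
qed

theorem theorem9:
  fixes v :: "'p::finite \<Rightarrow> real ^ 'n"
  assumes "generic_extremities v"
  shows "nonredundant_apices v
           {a. \<exists>I j. I \<noteq> {} \<and> I \<noteq> UNIV \<and> j \<notin> I \<and> is_vertex v I j a} \<and>
         (\<forall>a I j I' j'.
           I \<noteq> {} \<and> I \<noteq> UNIV \<and> j \<notin> I \<and> is_vertex v I j a \<and>
           I' \<noteq> {} \<and> I' \<noteq> UNIV \<and> j' \<notin> I' \<and> is_vertex v I' j' a \<longrightarrow> I = I') \<and>
         (\<forall>\<Gamma>. nonredundant_ext_rep v \<Gamma> \<and> (\<forall>H\<in>\<Gamma>. minimal_halfspace v H) \<longleftrightarrow>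
           \<Gamma> = {halfspace a I | a I j. I \<noteq> {} \<and> I \<noteq> UNIV \<and> j \<notin> I \<and> is_vertex v I j a})"
  unfolding vertices_def[symmetric] vertex_halfspaces_def[symmetric]
proof (intro conjI allI impI iffI)
  show "nonredundant_apices v (vertices v)"
    using assms by (rule nonredundant_apices_vertices)
next
  fix a :: "'n trop_proj" and I j I' j'
  assume "I \<noteq> {} \<and> I \<noteq> UNIV \<and> j \<notin> I \<and> is_vertex v I j a \<and>
    I' \<noteq> {} \<and> I' \<noteq> UNIV \<and> j' \<notin> I' \<and> is_vertex v I' j' a"
  moreover obtain a' where "a = proj a'"
    by (rule proj_cases)
  ultimately show "I = I'"
    using vertex_support_unique[OF assms] by blast
next
  fix \<Gamma>
  assume "nonredundant_ext_rep v \<Gamma> \<and> (\<forall>H\<in>\<Gamma>. minimal_halfspace v H)"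
  then show "\<Gamma> = vertex_halfspaces v"
    using nonredundant_ext_rep_minimal_eq[OF assms] by blast
next
  fix \<Gamma>
  assume "\<Gamma> = vertex_halfspaces v"
  then show "nonredundant_ext_rep v \<Gamma>" "\<forall>H\<in>\<Gamma>. minimal_halfspace v H"
    using nonredundant_ext_rep_vertex_halfspaces[OF assms] minimal_vertex_halfspaces by auto
qed

end
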